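(* Let $\alpha\in(0,1)$, let $\mathcal E$ be an error criterion, let $\mathcal R(\cdot,\cdot;\cdot)$ be a procedure and $\mathcal S^{(0)}(\cdot,\cdot;\cdot)$ an initial selection rule, defined for training, calibration and test samples of any sizes, such that: (i) for any training sample $\mathcal D_{train}$, calibration sample $\mathcal D_{cal}=(X_j,Y_j)_{1\le j\le n_{cal}}$ and test sample $\mathcal D_{test}=(X_j,Y_j)_{n_{cal}+1\le j\le n_{cal}+n_{test}}$ with joint distribution $Q$, the procedure $\mathcal R=\mathcal R(\mathcal D_{cal},\mathcal D^X_{test};\mathcal D_{train})=(\mathcal C_{n_{cal}+i})_{i\in\mathcal S}$, $\mathcal S\subset\{1,\dots,n_{test}\}$, $\mathcal C_{n_{cal}+i}\subset\mathcal Y$, satisfies $\mathbb E_Q(\mathcal E(\mathcal R,Y))\le\alpha$ whenever the entries of $\mathcal D_{cal}\cup\mathcal D_{test}$ are exchangeable conditionally on $\mathcal D_{train}$; (ii) the rule $\mathcal S^{(0)}(\mathcal D_{cal},\mathcal D^X_{test};\mathcal D_{train})\subset\{n_{cal}+1,\dots,n_{cal}+n_{test}\}$ is permutation preserving: for any permutation $\sigma$ of $\{n_{cal}+1,\dots,n_{cal}+n_{test}\}$, $\sigma\big(\mathcal S^{(0)}(\mathcal D_{cal},\mathcal D^X_{test};\mathcal D_{train})\big)=\mathcal S^{(0)}(\mathcal D_{cal},\sigma(\mathcal D^X_{test});\mathcal D_{train})$. Consider samples $(\mathcal D_{train},\mathcal D_{cal},\mathcal D_{test})$ with distribution $Q$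 such that the entries of $\mathcal D_{cal}\cup\mathcal D_{test}$ are exchangeable conditionally on $\mathcal D_{train}$. Split $\mathcal D_{cal}$ into $\mathcal D^{(1)}_{cal}=(X_j,Y_j)_{1\le j\le n^{(1)}_{cal}}$ and $\mathcal D^{(2)}_{cal}=(X_j,Y_j)_{n^{(1)}_{cal}+1\le j\le n_{cal}}$, and let $\mathcal D^{(2),X}_{cal}=(X_j)_{n^{(1)}_{cal}+1\le j\le n_{cal}}$. Let $$\mathcal S^{(0)}=\mathcal S^{(0)}\big(\mathcal D^{(1)}_{cal},\mathcal D^{(2),X}_{cal}\cup\mathcal D^X_{test};\mathcal D_{train}\big)\subset\{n^{(1)}_{cal}+1,\dots,n_{cal}+n_{test}\}.$$ Then the procedure $\mathcal R^{split}=\mathcal R\big((\mathcal D^{(2)}_{cal})_{\mathcal S^{(0)}},(\mathcal D^X_{test})_{\mathcal S^{(0)}};\mathcal D_{train}\big)$ satisfies $$\mathbb E_Q\big(\mathcal E(\mathcal R^{split},Y)\,\big|\,\mathcal S^{(0)}\big)\le\alpha,\qquad\text{and thus also}\qquad \mathbb E_Q\big(\mathcal E(\mathcal R^{split},Y)\big)\le\alpha .$$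
   Context: $\mathcal D^X_{test}=(X_j)_{n_{cal}+1\le j\le n_{cal}+n_{test}}$ denotes the covariates of the test sample. $\mathcal D_1\cup\mathcal D_2$ is the concatenation of two samples. For an indexed sample $\mathcal D$ and an index set $A$, $(\mathcal D)_{A}$ is the subsample of the entries of $\mathcal D$ whose index belongs to $A$. For a permutation $\sigma$ of the index set, $\sigma(\mathcal D^X_{test})$ is the relabelled sample in which the covariate of index $j$ is moved to index $\sigma(j)$, and $\sigma(A)=\{\sigma(j):j\in A\}$. A procedure is a measurable function of the training sample, the calibration sample and the test covariates that outputs a selected subset of the test sample and a prediction set (subset of the outcome space $\mathcal Y$) for each selected test point. An error criterion $\mathcal E(\mathcal R,Y)$ is a (measurable, nonnegative) function of the procedure's output and of the outcomes $Y$ of the test sample to which the procedure is applied, for example the false coverage proportion: number of selected test points whose outcome is not in their prediction set, divided by the maximum of $1$ and the number of selected points. *)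

theory Defs
  imports "HOL-Probability.Probability" "HOL-Combinatorics.Permutations"
begin

text \<open>
  A sample of size \<open>n\<close> is a list of length \<open>n\<close>, so that procedures are defined for samples of all
  sizes (including 0) and \<open>\<union>\<close> of samples is concatenation. Indices are counted from 0: when a
  calibration sample of size \<open>k\<close> and a test sample of size \<open>n\<close> are considered together, their entries
  carry the indices \<open>0, \<dots>, k - 1\<close> and \<open>k, \<dots>, k + n - 1\<close>.
\<close>

definition list_space :: "nat \<Rightarrow> 'a measure \<Rightarrow> 'a list measure" where
  "list_space n M =
     vimage_algebra {xs. length xs = n \<and> set xs \<subseteq> space M}
       (\<lambda>xs. \<lambda>i\<in>{..<n}. xs ! i) (\<Pi>\<^sub>M i\<in>{..<n}. M)"

lemma space_list_space: "space (list_space n M) = {xs. length xs = n \<and> set xs \<subseteq> space M}"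
  by (simp add: list_space_def)

text \<open>The triples (training sample, calibration sample, test sample) of given sizes.\<close>

definition data_space ::
  "'x measure \<Rightarrow> 'y measure \<Rightarrow> nat \<Rightarrow> nat \<Rightarrow> nat \<Rightarrow>
   (('x \<times> 'y) list \<times> ('x \<times> 'y) list \<times> ('x \<times> 'y) list) measure" where
  "data_space MX MY m k n =
     list_space m (MX \<Otimes>\<^sub>M MY) \<Otimes>\<^sub>M (list_space k (MX \<Otimes>\<^sub>M MY) \<Otimes>\<^sub>M list_space n (MX \<Otimes>\<^sub>M MY))"

text \<open>What a procedure is applied to: calibration sample, test covariates, training sample.\<close>

definition input_space ::
  "'x measure \<Rightarrow> 'y measure \<Rightarrow> nat \<Rightarrow> nat \<Rightarrow> nat \<Rightarrow>
   (('x \<times> 'y) list \<times> 'x list \<times> ('x \<times> 'y) list) measure" where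
  "input_space MX MY k n m =
     list_space k (MX \<Otimes>\<^sub>M MY) \<Otimes>\<^sub>M (list_space n MX \<Otimes>\<^sub>M list_space m (MX \<Otimes>\<^sub>M MY))"

text \<open>
  Given \<open>T\<close>, the conditional law of the random list \<open>D\<close> of \<open>n\<close> entries is invariant under
  permutations of its entries: \<open>P(\<pi>(D) \<in> B | T) = P(D \<in> B | T)\<close> almost surely.
\<close>

definition exchangeable_given ::
  "'w measure \<Rightarrow> 't measure \<Rightarrow> ('w \<Rightarrow> 't) \<Rightarrow> nat \<Rightarrow> 'a measure \<Rightarrow> ('w \<Rightarrow> 'a list) \<Rightarrow> bool" where
  "exchangeable_given Q N T n M D \<longleftrightarrow>
     (\<forall>\<pi> B. \<pi> permutes {..<n} \<longrightarrow> B \<in> sets (list_space n M) \<longrightarrow>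
       (AE w in Q.
          real_cond_exp Q (vimage_algebra (space Q) T N) (\<lambda>w. indicator B (permute_list \<pi> (D w))) w =
          real_cond_exp Q (vimage_algebra (space Q) T N) (\<lambda>w. indicator B (D w)) w))"

text \<open>\<open>Q\<close> is a joint law under which calibration and test entries together are exchangeable given
  the training sample.\<close>

definition exchangeable_law ::
  "'x measure \<Rightarrow> 'y measure \<Rightarrow> nat \<Rightarrow> nat \<Rightarrow> nat \<Rightarrow>
   (('x \<times> 'y) list \<times> ('x \<times> 'y) list \<times> ('x \<times> 'y) list) measure \<Rightarrow> bool" where
  "exchangeable_law MX MY m k n Q \<longleftrightarrow>
     prob_space Q \<and> sets Q = sets (data_space MX MY m k n) \<and>
     exchangeable_given Q (list_space m (MX \<Otimes>\<^sub>M MY)) (\<lambda>(t, c, z). t)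
       (k + n) (MX \<Otimes>\<^sub>M MY) (\<lambda>(t, c, z). c @ z)"

text \<open>
  A procedure outputs a family of prediction sets indexed by the selected test points, i.e. a partial
  map from test positions \<open>0, \<dots>, n - 1\<close> to subsets of the outcome space, whose domain is the
  selection. \<open>Out n\<close> is the sigma-algebra with respect to which such families are measured when there
  are \<open>n\<close> test points; it is a parameter, as there is no canonical choice.
\<close>

type_synonym ('x, 'y) procedure =
  "('x \<times> 'y) list \<Rightarrow> 'x list \<Rightarrow> ('x \<times> 'y) list \<Rightarrow> (nat \<rightharpoonup> 'y set)"

definition is_procedure ::
  "'x measure \<Rightarrow> 'y measure \<Rightarrow> (nat \<Rightarrow> (nat \<rightharpoonup> 'y set) measure) \<Rightarrow> ('x, 'y) procedure \<Rightarrow> bool" where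
  "is_procedure MX MY Out R \<longleftrightarrow>
     (\<forall>k n m.
        (\<lambda>(c, x, t). R c x t) \<in> input_space MX MY k n m \<rightarrow>\<^sub>M Out n \<and>
        (\<forall>(c, x, t) \<in> space (input_space MX MY k n m).
           dom (R c x t) \<subseteq> {..<n} \<and> ran (R c x t) \<subseteq> Pow (space MY)))"

definition error_criterion ::
  "'y measure \<Rightarrow> (nat \<Rightarrow> (nat \<rightharpoonup> 'y set) measure) \<Rightarrow> ((nat \<rightharpoonup> 'y set) \<Rightarrow> 'y list \<Rightarrow> real) \<Rightarrow> bool" where
  "error_criterion MY Out E \<longleftrightarrow>
     (\<forall>n. (\<lambda>(C, y). E C y) \<in> borel_measurable (Out n \<Otimes>\<^sub>M list_space n MY) \<and>
          (\<forall>C \<in> space (Out n). \<forall>y \<in> space (list_space n MY). 0 \<le> E C y))"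

type_synonym ('x, 'y) selection =
  "('x \<times> 'y) list \<Rightarrow> 'x list \<Rightarrow> ('x \<times> 'y) list \<Rightarrow> nat set"

definition selection_rule :: "'x measure \<Rightarrow> 'y measure \<Rightarrow> ('x, 'y) selection \<Rightarrow> bool" where
  "selection_rule MX MY S0 \<longleftrightarrow>
     (\<forall>k n m.
        (\<lambda>(c, x, t). S0 c x t) \<in> input_space MX MY k n m \<rightarrow>\<^sub>M count_space UNIV \<and>
        (\<forall>(c, x, t) \<in> space (input_space MX MY k n m). S0 c x t \<subseteq> {k..<k + n}))"

text \<open>For a sample with indices \<open>k, k + 1, \<dots>\<close>: moves the entry of index \<open>j\<close> to index \<open>\<sigma> j\<close>.\<close>

definition relabel :: "nat \<Rightarrow> (nat \<Rightarrow> nat) \<Rightarrow> 'a list \<Rightarrow> 'a list" where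
  "relabel k \<sigma> xs = map (\<lambda>j. xs ! (inv \<sigma> j - k)) [k..<k + length xs]"

lemma relabel_nth:
  assumes "\<sigma> permutes {k..<k + length xs}" and "j \<in> {k..<k + length xs}"
  shows "relabel k \<sigma> xs ! (\<sigma> j - k) = xs ! (j - k)"
proof -
  have "\<sigma> j \<in> {k..<k + length xs}"
    using assms by (simp only: permutes_in_image)
  then show ?thesis
    using permutes_inverses(2)[OF assms(1)] by (auto simp: relabel_def)
qed

definition permutation_preserving :: "'x measure \<Rightarrow> 'y measure \<Rightarrow> ('x, 'y) selection \<Rightarrow> bool" where
  "permutation_preserving MX MY S0 \<longleftrightarrow>
     (\<forall>k n m \<sigma>. \<sigma> permutes {k..<k + n} \<longrightarrow>
        (\<forall>(c, x, t) \<in> space (input_space MX MY k n m). \<sigma> ` S0 c x t = S0 c (relabel k \<sigma> x) t))"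

text \<open>For a sample with indices \<open>k, k + 1, \<dots>\<close>: the entries with index in \<open>A\<close>, in their order.\<close>

definition subsample :: "nat \<Rightarrow> 'a list \<Rightarrow> nat set \<Rightarrow> 'a list" where
  "subsample k xs A = nths xs {i. k + i \<in> A}"

text \<open>In the following, \<open>n1\<close> is the size of the first part of the calibration sample \<open>c\<close>.\<close>

definition initial_selection ::
  "('x, 'y) selection \<Rightarrow> nat \<Rightarrow> ('x \<times> 'y) list \<Rightarrow> 'x list \<Rightarrow> ('x \<times> 'y) list \<Rightarrow> nat set" where
  "initial_selection S0 n1 c x t = S0 (take n1 c) (map fst (drop n1 c) @ x) t"

definition split_procedure ::
  "('x, 'y) procedure \<Rightarrow> ('x, 'y) selection \<Rightarrow> nat \<Rightarrow> ('x, 'y) procedure" where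
  "split_procedure R S0 n1 c x t =
     (let S = initial_selection S0 n1 c x t
      in R (subsample n1 (drop n1 c) S) (subsample (length c) x S) t)"

text \<open>The split procedure is \<open>R\<close> applied to the initially selected test points, so its error is
  evaluated on the outcomes of these points.\<close>

definition split_error ::
  "((nat \<rightharpoonup> 'y set) \<Rightarrow> 'y list \<Rightarrow> real) \<Rightarrow> ('x, 'y) procedure \<Rightarrow> ('x, 'y) selection \<Rightarrow> nat \<Rightarrow>
   ('x \<times> 'y) list \<Rightarrow> ('x \<times> 'y) list \<Rightarrow> ('x \<times> 'y) list \<Rightarrow> real" where
  "split_error E R S0 n1 t c z =
     E (split_procedure R S0 n1 c (map fst z) t)
       (subsample (length c) (map snd z) (initial_selection S0 n1 c (map fst z) t))"

end

theory Submission
  imports Defs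
begin

text \<open>
  The split procedure is \<open>R\<close> applied to data whose size is random, because the initial selection decides
  how many points are kept. Conditionally on the event that the initial selection equals a fixed set
  \<open>s\<close>, the sizes become deterministic, and the idea is that the kept data are still exchangeable given
  the training sample; the error control assumed for \<open>R\<close> then applies to this conditional law.

  Why exchangeability survives: let \<open>D\<close> be the calibration sample followed by the test sample, and \<open>t\<close>
  the training sample. Conditional exchangeability of \<open>D\<close> given \<open>t\<close> means that the joint law of
  \<open>(t, D)\<close> is invariant under every permutation of the entries of \<open>D\<close> (lemma
  \<open>exchangeable_given_iff_law\<close>). A permutation of the kept entries is the restriction of a permutation
  \<open>\<sigma>\<close> of the index set \<open>s\<close>, which fixes every other index (\<open>nths_permutation_lift\<close>). Such a \<open>\<sigma>\<close> leaves
  the first part of the calibration sample alone and relabels the points on which the selection is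
  made. As the selection rule is permutation preserving and \<open>\<sigma>\<close> maps \<open>s\<close> onto itself, the selection
  equals \<open>s\<close> before the relabelling if and only if it does so afterwards
  (\<open>pooled_selection_permute\<close>). Hence \<open>\<sigma>\<close> preserves both the law of \<open>(t, D)\<close> and the conditioning
  event, and therefore the conditional law (\<open>exchangeable_law_given_selection\<close>).

  The selection takes finitely many values. The bound on each event where it is constant gives the
  bound for the conditional expectation given the selection, and for the expectation
  (\<open>bounds_from_level_sets\<close>).
\<close>

section \<open>Measurability of list operations\<close>

lemma measurable_list_nth:
  assumes "i < n"
  shows "(\<lambda>xs. xs ! i) \<in> list_space n M \<rightarrow>\<^sub>M M"
proof -
  have "(\<lambda>xs. \<lambda>i\<in>{..<n}. xs ! i) \<in> list_space n M \<rightarrow>\<^sub>M (\<Pi>\<^sub>M i\<in>{..<n}. M)"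
    unfolding list_space_def
    by (rule measurable_vimage_algebra1) (auto simp: space_PiM PiE_def Pi_def subset_iff)
  then have "(\<lambda>xs. (\<lambda>i\<in>{..<n}. xs ! i) i) \<in> list_space n M \<rightarrow>\<^sub>M M"
    by (rule measurable_compose[OF _ measurable_component_singleton]) (use assms in auto)
  then show ?thesis using assms by simp
qed

lemma measurable_list_spaceI:
  assumes "\<And>w. w \<in> space N \<Longrightarrow> length (f w) = n"
    and "\<And>i. i < n \<Longrightarrow> (\<lambda>w. f w ! i) \<in> N \<rightarrow>\<^sub>M M"
  shows "f \<in> N \<rightarrow>\<^sub>M list_space n M"
  unfolding list_space_def
proof (rule measurable_vimage_algebra2)
  show "f \<in> space N \<rightarrow> {xs. length xs = n \<and> set xs \<subseteq> space M}"
    using assms(1) measurable_space[OF assms(2)] by (fastforce simp: in_set_conv_nth)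
  show "(\<lambda>w. \<lambda>i\<in>{..<n}. f w ! i) \<in> N \<rightarrow>\<^sub>M (\<Pi>\<^sub>M i\<in>{..<n}. M)"
    by (intro measurable_restrict) (use assms(2) in auto)
qed

lemma length_list_space:
  assumes "f \<in> N \<rightarrow>\<^sub>M list_space n M" "w \<in> space N"
  shows "length (f w) = n"
  using measurable_space[OF assms] by (simp add: space_list_space)

lemma measurable_list_append:
  assumes f: "f \<in> N \<rightarrow>\<^sub>M list_space a M" and g: "g \<in> N \<rightarrow>\<^sub>M list_space b M"
  shows "(\<lambda>w. f w @ g w) \<in> N \<rightarrow>\<^sub>M list_space (a + b) M"
proof (rule measurable_list_spaceI)
  show "length (f w @ g w) = a + b" if "w \<in> space N" for w
    using length_list_space[OF f that] length_list_space[OF g that] by simp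
  show "(\<lambda>w. (f w @ g w) ! i) \<in> N \<rightarrow>\<^sub>M M" if "i < a + b" for i
  proof (cases "i < a")
    case True
    have "(\<lambda>w. f w ! i) \<in> N \<rightarrow>\<^sub>M M"
      by (rule measurable_compose[OF f measurable_list_nth[OF True]])
    then show ?thesis
      by (rule measurable_cong[THEN iffD1, rotated]) (simp add: nth_append length_list_space[OF f] True)
  next
    case False
    have "(\<lambda>w. g w ! (i - a)) \<in> N \<rightarrow>\<^sub>M M"
      by (rule measurable_compose[OF g measurable_list_nth]) (use False that in auto)
    then show ?thesis
      by (rule measurable_cong[THEN iffD1, rotated]) (simp add: nth_append length_list_space[OF f] False)
  qed
qed

lemma measurable_list_map:
  assumes f: "f \<in> N \<rightarrow>\<^sub>M list_space n M" and h: "h \<in> M \<rightarrow>\<^sub>M M'"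
  shows "(\<lambda>w. map h (f w)) \<in> N \<rightarrow>\<^sub>M list_space n M'"
proof (rule measurable_list_spaceI)
  show "length (map h (f w)) = n" if "w \<in> space N" for w
    using length_list_space[OF f that] by simp
  show "(\<lambda>w. map h (f w) ! i) \<in> N \<rightarrow>\<^sub>M M'" if "i < n" for i
  proof -
    have "(\<lambda>w. h (f w ! i)) \<in> N \<rightarrow>\<^sub>M M'"
      by (intro measurable_compose[OF measurable_compose[OF f measurable_list_nth[OF that]] h])
    then show ?thesis
      by (rule measurable_cong[THEN iffD1, rotated]) (simp add: length_list_space[OF f] that)
  qed
qed

text \<open>
  Separates the positions that are kept, which depend on the list only through its length, from the
  entries found there.
\<close>

lemma nths_conv_map_nth: "nths xs A = map ((!) xs) (nths [0..<length xs] A)"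
  by (simp add: nths_map[symmetric] map_nth)

lemma measurable_list_nths:
  assumes f: "f \<in> N \<rightarrow>\<^sub>M list_space n M"
  shows "(\<lambda>w. nths (f w) A) \<in> N \<rightarrow>\<^sub>M list_space (card {i. i < n \<and> i \<in> A}) M"
proof (rule measurable_list_spaceI)
  show "length (nths (f w) A) = card {i. i < n \<and> i \<in> A}" if "w \<in> space N" for w
    using length_list_space[OF f that] by (simp add: length_nths)
  show "(\<lambda>w. nths (f w) A ! i) \<in> N \<rightarrow>\<^sub>M M" if i: "i < card {i. i < n \<and> i \<in> A}" for i
  proof -
    let ?e = "nths [0..<n] A"
    have i': "i < length ?e" using i by (simp add: length_nths)
    then have "?e ! i < n" using in_set_nthsD[OF nth_mem[OF i']] by simp
    then have "(\<lambda>w. f w ! (?e ! i)) \<in> N \<rightarrow>\<^sub>M M"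
      by (rule measurable_compose[OF f measurable_list_nth])
    then show ?thesis
      by (rule measurable_cong[THEN iffD1, rotated])
        (simp add: nths_conv_map_nth[of "f _"] length_list_space[OF f] i')
  qed
qed

lemma measurable_list_permute:
  assumes f: "f \<in> N \<rightarrow>\<^sub>M list_space n M" and p: "p permutes {..<n}"
  shows "(\<lambda>w. permute_list p (f w)) \<in> N \<rightarrow>\<^sub>M list_space n M"
proof (rule measurable_list_spaceI)
  show "length (permute_list p (f w)) = n" if "w \<in> space N" for w
    using length_list_space[OF f that] by simp
  show "(\<lambda>w. permute_list p (f w) ! i) \<in> N \<rightarrow>\<^sub>M M" if "i < n" for i
  proof -
    have "p i < n" using permutes_in_image[OF p, of i] that by simp
    then have "(\<lambda>w. f w ! p i) \<in> N \<rightarrow>\<^sub>M M"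
      by (rule measurable_compose[OF f measurable_list_nth])
    then show ?thesis
      by (rule measurable_cong[THEN iffD1, rotated])
        (simp add: permute_list_nth length_list_space[OF f] p that)
  qed
qed

lemma measurable_list_drop:
  assumes f: "f \<in> N \<rightarrow>\<^sub>M list_space n M"
  shows "(\<lambda>w. drop a (f w)) \<in> N \<rightarrow>\<^sub>M list_space (n - a) M"
proof -
  have "{i. i < n \<and> i \<in> {i. a \<le> i}} = {a..<n}" by auto
  then show ?thesis
    using measurable_list_nths[OF f, of "{i. a \<le> i}"] by (simp add: drop_eq_nths)
qed

lemma measurable_list_take:
  assumes f: "f \<in> N \<rightarrow>\<^sub>M list_space n M" and "a \<le> n"
  shows "(\<lambda>w. take a (f w)) \<in> N \<rightarrow>\<^sub>M list_space a M"
proof -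
  have "{i. i < n \<and> i \<in> {..<a}} = {..<a}" using assms by auto
  then show ?thesis
    using measurable_list_nths[OF f, of "{..<a}"] by simp
qed

lemma measurable_subsample:
  assumes f: "f \<in> N \<rightarrow>\<^sub>M list_space n M"
  shows "(\<lambda>w. subsample a (f w) s) \<in> N \<rightarrow>\<^sub>M list_space (card (s \<inter> {a..<a + n})) M"
proof -
  have "bij_betw ((+) a) {i. i < n \<and> i \<in> {i. a + i \<in> s}} (s \<inter> {a..<a + n})"
    by (rule bij_betw_byWitness[where f' = "\<lambda>j. j - a"]) auto
  from bij_betw_same_card[OF this] show ?thesis
    using measurable_list_nths[OF f, of "{i. a + i \<in> s}"] by (simp add: subsample_def)
qed

section \<open>Conditional exchangeability as invariance of a joint law\<close>

text \<open>
  Measurable rectangles form an intersection-stable generator of the product sigma-algebra.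
\<close>

lemma law_pair_eqI:
  assumes "prob_space Q" and T[measurable]: "T \<in> Q \<rightarrow>\<^sub>M N"
    and D[measurable]: "D \<in> Q \<rightarrow>\<^sub>M L" and D'[measurable]: "D' \<in> Q \<rightarrow>\<^sub>M L"
    and eq: "\<And>A B. A \<in> sets N \<Longrightarrow> B \<in> sets L \<Longrightarrow>
      measure Q {w \<in> space Q. T w \<in> A \<and> D w \<in> B} = measure Q {w \<in> space Q. T w \<in> A \<and> D' w \<in> B}"
  shows "distr Q (N \<Otimes>\<^sub>M L) (\<lambda>w. (T w, D w)) = distr Q (N \<Otimes>\<^sub>M L) (\<lambda>w. (T w, D' w))"
proof -
  interpret prob_space Q by fact
  let ?E = "{a \<times> b |a b. a \<in> sets N \<and> b \<in> sets L}"
  show ?thesis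
  proof (rule measure_eqI_generator_eq[where E = ?E and \<Omega> = "space N \<times> space L"
        and A = "\<lambda>_. space N \<times> space L"])
    show "Int_stable ?E" by (rule Int_stable_pair_measure_generator)
    show "?E \<subseteq> Pow (space N \<times> space L)"
      using sets.space_closed[of N] sets.space_closed[of L] by blast
    fix X assume "X \<in> ?E"
    then obtain a b where X: "X = a \<times> b" and [measurable]: "a \<in> sets N" "b \<in> sets L" by auto
    have 1: "(\<lambda>w. (T w, F w)) -` (a \<times> b) \<inter> space Q = {w \<in> space Q. T w \<in> a \<and> F w \<in> b}" for F
      by auto
    show "emeasure (distr Q (N \<Otimes>\<^sub>M L) (\<lambda>w. (T w, D w))) X
        = emeasure (distr Q (N \<Otimes>\<^sub>M L) (\<lambda>w. (T w, D' w))) X"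
      using eq[of a b] by (simp add: X emeasure_distr 1 emeasure_eq_measure)
  next
    show "emeasure (distr Q (N \<Otimes>\<^sub>M L) (\<lambda>w. (T w, D w))) (space N \<times> space L) \<noteq> \<infinity>"
      by (simp add: emeasure_distr emeasure_eq_measure)
  qed (auto simp: sets_pair_measure)
qed

text \<open>
  The events of the sigma-algebra generated by \<open>T\<close> are \<open>{T \<in> A}\<close>. Two conditional probabilities given
  \<open>T\<close> therefore agree almost surely if and only if they have the same integral over each of these
  events, that is, if the two joint laws with \<open>T\<close> agree on the rectangles \<open>A \<times> B\<close>. In contrast to
  the conditional formulation, the invariance of a joint law applies to events that involve \<open>T\<close> and
  \<open>D\<close> together, such as the event that a selection computed from both takes a given value.
\<close>

lemma exchangeable_given_iff_law:
  assumes "prob_space Q" and T[measurable]: "T \<in> Q \<rightarrow>\<^sub>M N"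
    and D[measurable]: "D \<in> Q \<rightarrow>\<^sub>M list_space n M"
  shows "exchangeable_given Q N T n M D \<longleftrightarrow>
    (\<forall>\<pi>. \<pi> permutes {..<n} \<longrightarrow>
      distr Q (N \<Otimes>\<^sub>M list_space n M) (\<lambda>w. (T w, permute_list \<pi> (D w))) =
      distr Q (N \<Otimes>\<^sub>M list_space n M) (\<lambda>w. (T w, D w)))"
proof -
  interpret prob_space Q by fact
  let ?F = "vimage_algebra (space Q) T N"
  have T_space: "T \<in> space Q \<rightarrow> space N" using measurable_space[OF T] by auto
  have sets_F: "sets ?F = {T -` A \<inter> space Q |A. A \<in> sets N}"
    by (rule sets_vimage_algebra2[OF T_space])
  have "subalgebra Q ?F"
    unfolding subalgebra_def sets_F by (auto intro: measurable_sets[OF T])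
  then interpret finite_measure_subalgebra Q ?F
    by unfold_locales
  have set_int: "(\<integral>w\<in>T -` A \<inter> space Q. indicator B (F w) \<partial>Q) = measure Q {w \<in> space Q. T w \<in> A \<and> F w \<in> B}"
    if "F \<in> Q \<rightarrow>\<^sub>M list_space n M" "A \<in> sets N" "B \<in> sets (list_space n M)"
    for F A and B :: "'c list set"
  proof -
    have "(\<integral>w\<in>T -` A \<inter> space Q. indicator B (F w) \<partial>Q)
      = (\<integral>w. indicator {w \<in> space Q. T w \<in> A \<and> F w \<in> B} w \<partial>Q)"
      unfolding set_lebesgue_integral_def
      by (rule Bochner_Integration.integral_cong) (auto simp: indicator_def)
    also have "\<dots> = measure Q {w \<in> space Q. T w \<in> A \<and> F w \<in> B}"
      by (simp add: Int_def conj_commute)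
    finally show ?thesis .
  qed
  have int: "integrable Q (\<lambda>w. indicator B (F w) :: real)"
    if [measurable]: "F \<in> Q \<rightarrow>\<^sub>M list_space n M" "B \<in> sets (list_space n M)"
    for F and B :: "'c list set"
    by (rule integrable_const_bound[where B = 1]) (auto simp: indicator_def)
  have "(\<forall>B \<in> sets (list_space n M). AE w in Q.
          real_cond_exp Q ?F (\<lambda>w. indicator B (permute_list \<pi> (D w))) w =
          real_cond_exp Q ?F (\<lambda>w. indicator B (D w)) w) \<longleftrightarrow>
      distr Q (N \<Otimes>\<^sub>M list_space n M) (\<lambda>w. (T w, permute_list \<pi> (D w))) =
      distr Q (N \<Otimes>\<^sub>M list_space n M) (\<lambda>w. (T w, D w))" (is "?ce \<longleftrightarrow> ?law")
    if \<pi>: "\<pi> permutes {..<n}" for \<pi>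
  proof -
    have D'[measurable]: "(\<lambda>w. permute_list \<pi> (D w)) \<in> Q \<rightarrow>\<^sub>M list_space n M"
      by (rule measurable_list_permute[OF D \<pi>])
    show ?thesis
    proof
      assume ce: ?ce
      show ?law
      proof (rule law_pair_eqI)
        fix A B assume A: "A \<in> sets N" and B: "B \<in> sets (list_space n M)"
        have TA: "T -` A \<inter> space Q \<in> sets ?F" using A sets_F by auto
        have TA': "T -` A \<inter> space Q \<in> sets Q" using A by measurable
        have "(\<integral>w\<in>T -` A \<inter> space Q. indicator B (permute_list \<pi> (D w)) \<partial>Q)
          = (\<integral>w\<in>T -` A \<inter> space Q. real_cond_exp Q ?F (\<lambda>w. indicator B (permute_list \<pi> (D w))) w \<partial>Q)"
          by (rule real_cond_exp_intA[OF int[OF D' B] TA])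
        also have "\<dots> = (\<integral>w\<in>T -` A \<inter> space Q. real_cond_exp Q ?F (\<lambda>w. indicator B (D w)) w \<partial>Q)"
          unfolding set_lebesgue_integral_def
          by (rule integral_cong_AE) (use ce B TA' in \<open>auto elim!: eventually_mono dest!: bspec[of _ _ B]\<close>)
        also have "\<dots> = (\<integral>w\<in>T -` A \<inter> space Q. indicator B (D w) \<partial>Q)"
          by (rule real_cond_exp_intA[OF int[OF D B] TA, symmetric])
        finally show "measure Q {w \<in> space Q. T w \<in> A \<and> permute_list \<pi> (D w) \<in> B} =
            measure Q {w \<in> space Q. T w \<in> A \<and> D w \<in> B}"
          by (simp add: set_int[OF D' A B] set_int[OF D A B])
      qed (use assms D' in auto)
    next
      assume law: ?law
      show ?ce
      proof
        fix B assume B: "B \<in> sets (list_space n M)"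
        show "AE w in Q. real_cond_exp Q ?F (\<lambda>w. indicator B (permute_list \<pi> (D w))) w =
          real_cond_exp Q ?F (\<lambda>w. indicator B (D w)) w"
        proof (rule real_cond_exp_charact)
          fix C assume C: "C \<in> sets ?F"
          then obtain A where A: "A \<in> sets N" and C_eq: "C = T -` A \<inter> space Q" using sets_F by auto
          have "measure (distr Q (N \<Otimes>\<^sub>M list_space n M) (\<lambda>w. (T w, F w))) (A \<times> B)
            = measure Q {w \<in> space Q. T w \<in> A \<and> F w \<in> B}"
            if [measurable]: "F \<in> Q \<rightarrow>\<^sub>M list_space n M" for F
            using A B by (subst measure_distr) (auto intro!: arg_cong[where f = "measure Q"])
          from this[OF D'] this[OF D] law
          have "(\<integral>w\<in>C. indicat_real B (permute_list \<pi> (D w)) \<partial>Q) = (\<integral>w\<in>C. indicator B (D w) \<partial>Q)"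
            by (simp add: C_eq set_int[OF D' A B] set_int[OF D A B])
          also have "\<dots> = (\<integral>w\<in>C. real_cond_exp Q ?F (\<lambda>w. indicator B (D w)) w \<partial>Q)"
            by (rule real_cond_exp_intA[OF int[OF D B] C])
          finally show "(\<integral>w\<in>C. indicator B (permute_list \<pi> (D w)) \<partial>Q) =
            (\<integral>w\<in>C. real_cond_exp Q ?F (\<lambda>w. indicator B (D w)) w \<partial>Q)" .
        qed (use int[OF D' B] real_cond_exp_int(1)[OF int[OF D B]] in auto)
      qed
    qed
  qed
  then show ?thesis
    unfolding exchangeable_given_def by blast
qed

lemma pooled_data_measurable:
  "(\<lambda>(t, c, z). (t, c @ z)) \<in> data_space MX MY m k n \<rightarrow>\<^sub>M
     list_space m (MX \<Otimes>\<^sub>M MY) \<Otimes>\<^sub>M list_space (k + n) (MX \<Otimes>\<^sub>M MY)"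
  unfolding data_space_def case_prod_beta
  by (intro measurable_Pair measurable_list_append measurable_fst
      measurable_compose[OF measurable_snd measurable_fst] measurable_compose[OF measurable_snd measurable_snd])

lemma permuted_pooled_data_measurable:
  assumes "\<pi> permutes {..<k + n}"
  shows "(\<lambda>(t, c, z). (t, permute_list \<pi> (c @ z))) \<in> data_space MX MY m k n \<rightarrow>\<^sub>M
     list_space m (MX \<Otimes>\<^sub>M MY) \<Otimes>\<^sub>M list_space (k + n) (MX \<Otimes>\<^sub>M MY)"
  using measurable_Pair[OF measurable_compose[OF pooled_data_measurable measurable_fst]
      measurable_list_permute[OF measurable_compose[OF pooled_data_measurable measurable_snd] assms]]
  by (simp add: split_beta')

lemma exchangeable_law_iff:
  fixes MX :: "'x measure" and MY :: "'y measure"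
  assumes "prob_space Q" "sets Q = sets (data_space MX MY m k n)"
  shows "exchangeable_law MX MY m k n Q \<longleftrightarrow>
    (\<forall>\<pi>. \<pi> permutes {..<k + n} \<longrightarrow>
      distr Q (list_space m (MX \<Otimes>\<^sub>M MY) \<Otimes>\<^sub>M list_space (k + n) (MX \<Otimes>\<^sub>M MY))
        (\<lambda>(t, c, z). (t, permute_list \<pi> (c @ z))) =
      distr Q (list_space m (MX \<Otimes>\<^sub>M MY) \<Otimes>\<^sub>M list_space (k + n) (MX \<Otimes>\<^sub>M MY))
        (\<lambda>(t, c, z). (t, c @ z)))"
proof -
  have meas: "measurable Q = measurable (data_space MX MY m k n)"
    by (intro ext measurable_cong_sets assms(2) refl)
  have T: "(\<lambda>(t, c, z). t) \<in> Q \<rightarrow>\<^sub>M list_space m (MX \<Otimes>\<^sub>M MY)"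
    unfolding meas data_space_def case_prod_beta by (rule measurable_fst)
  have D: "(\<lambda>(t, c, z). c @ z) \<in> Q \<rightarrow>\<^sub>M list_space (k + n) (MX \<Otimes>\<^sub>M MY)"
    unfolding meas using measurable_compose[OF pooled_data_measurable measurable_snd]
    by (simp add: split_beta')
  show ?thesis
    unfolding exchangeable_law_def using exchangeable_given_iff_law[OF assms(1) T D] assms
    by (simp add: split_beta')
qed

section \<open>Permuting the selected entries\<close>

lemma set_upt_nths: "set (nths [0..<n] A) = A \<inter> {..<n}"
  by (auto simp: set_nths) (metis add_0 nth_upt)

text \<open>
  The increasing enumeration \<open>e\<close> of \<open>s\<close> is a bijection from the positions in the subsample to the
  positions in \<open>D\<close>, and \<open>\<sigma>\<close> is \<open>\<pi>\<close> transported along \<open>e\<close>. It does not depend on \<open>D\<close>, so that it can be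
  applied to a random list.
\<close>

lemma nths_permutation_lift:
  assumes s: "s \<subseteq> {..<n}" and \<pi>: "\<pi> permutes {..<card s}"
  obtains \<sigma> where "\<sigma> permutes s"
    and "\<And>D. length D = n \<Longrightarrow> permute_list \<pi> (nths D s) = nths (permute_list \<sigma> D) s"
proof -
  define e where "e = nths [0..<n] s"
  have set_e: "set e = s" using s by (simp add: e_def set_upt_nths Int_absorb2)
  have dist: "distinct e" by (simp add: e_def)
  then have len_e: "length e = card s" using set_e distinct_card by metis
  have bij: "bij_betw ((!) e) {..<card s} s"
    using bij_betw_nth[OF dist] len_e set_e by simp
  define \<sigma> where "\<sigma> = (\<lambda>x. if x \<in> s then e ! (\<pi> (inv_into {..<card s} ((!) e) x)) else x)"
  have \<sigma>: "\<sigma> permutes s"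
    unfolding \<sigma>_def by (rule permutes_bij_inv_into[OF \<pi> bij])
  have \<sigma>_e: "\<sigma> (e ! i) = e ! \<pi> i" if "i < card s" for i
    using that bij bij_betw_inv_into_left[OF bij, of i] bij_betwE[OF bij] by (simp add: \<sigma>_def)
  show thesis
  proof (rule that[OF \<sigma>])
    fix D :: "'a list" assume D: "length D = n"
    have \<sigma>n: "\<sigma> permutes {..<length D}" using permutes_subset[OF \<sigma>] s D by simp
    have len: "length (nths D' s) = card s" if "length D' = n" for D' :: "'a list"
      using that by (simp add: nths_conv_map_nth[of D'] e_def[symmetric] len_e)
    have nth: "nths D' s ! i = D' ! (e ! i)" if "length D' = n" "i < card s" for i and D' :: "'a list"
      using that by (simp add: nths_conv_map_nth[of D'] e_def[symmetric] len_e)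
    show "permute_list \<pi> (nths D s) = nths (permute_list \<sigma> D) s"
    proof (rule nth_equalityI)
      show "length (permute_list \<pi> (nths D s)) = length (nths (permute_list \<sigma> D) s)"
        using D by (simp add: len)
      fix i assume "i < length (permute_list \<pi> (nths D s))"
      then have i: "i < card s" using D by (simp add: len)
      then have "\<pi> i < card s" using permutes_in_image[OF \<pi>, of i] by simp
      moreover have "e ! i < n" using bij_betwE[OF bij] i s by auto
      ultimately show "permute_list \<pi> (nths D s) ! i = nths (permute_list \<sigma> D) s ! i"
        using i D \<pi> \<sigma>n by (simp add: permute_list_nth len nth \<sigma>_e)
    qed
  qed
qed

text \<open>
  Each subsample numbers its entries from the index where its sample starts; with respect to the
  common numbering of \<open>c @ z\<close>, both keep the indices in \<open>s\<close>. As \<open>s\<close> has no index below \<open>n1\<close>, cutting off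
  the first \<open>n1\<close> entries loses nothing.
\<close>

lemma subsample_append:
  fixes n1 :: nat
  assumes "s \<subseteq> {n1..}" "n1 \<le> length c"
  shows "subsample n1 (drop n1 c) s @ subsample (length c) z s = nths (c @ z) s"
proof -
  have "(+) n1 ` {i. n1 + i \<in> s} = s"
  proof
    show "s \<subseteq> (+) n1 ` {i. n1 + i \<in> s}"
    proof
      fix j assume "j \<in> s"
      then show "j \<in> (+) n1 ` {i. n1 + i \<in> s}"
        using assms(1) by (intro image_eqI[of _ _ "j - n1"]) auto
    qed
  qed auto
  then show ?thesis
    by (simp add: subsample_def nths_drop nths_append add.commute)
qed

lemma card_selected:
  fixes n1 k n :: nat
  assumes "s \<subseteq> {n1..<k + n}" "n1 \<le> k"
  shows "card (s \<inter> {n1..<k}) + card (s \<inter> {k..<k + n}) = card s"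
proof -
  have "card (s \<inter> {n1..<k} \<union> s \<inter> {k..<k + n}) = card (s \<inter> {n1..<k}) + card (s \<inter> {k..<k + n})"
    by (rule card_Un_disjoint) auto
  moreover have "s \<inter> {n1..<k} \<union> s \<inter> {k..<k + n} = s" using assms by auto
  ultimately show ?thesis by simp
qed

text \<open>
  The initial selection as a function of the concatenated sample, on which permutations act.
\<close>

definition pooled_selection ::
  "('x, 'y) selection \<Rightarrow> nat \<Rightarrow> ('x \<times> 'y) list \<Rightarrow> ('x \<times> 'y) list \<Rightarrow> nat set" where
  "pooled_selection S0 n1 D t = S0 (take n1 D) (map fst (drop n1 D)) t"

lemma initial_selection_pooled:
  assumes "n1 \<le> length c"
  shows "initial_selection S0 n1 c (map fst z) t = pooled_selection S0 n1 (c @ z) t"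
  using assms by (simp add: initial_selection_def pooled_selection_def)

lemma pooled_input_measurable:
  assumes "n1 \<le> N"
  shows "(\<lambda>(t, D). (take n1 D, map fst (drop n1 D), t))
    \<in> list_space m (MX \<Otimes>\<^sub>M MY) \<Otimes>\<^sub>M list_space N (MX \<Otimes>\<^sub>M MY) \<rightarrow>\<^sub>M input_space MX MY n1 (N - n1) m"
  unfolding input_space_def case_prod_beta
  by (intro measurable_Pair measurable_list_take[OF _ assms] measurable_list_map[OF _ measurable_fst[of MX MY]]
      measurable_list_drop measurable_fst measurable_snd)

lemma pooled_selection_measurable:
  assumes "selection_rule MX MY S0" "n1 \<le> N"
  shows "(\<lambda>(t, D). pooled_selection S0 n1 D t)
    \<in> list_space m (MX \<Otimes>\<^sub>M MY) \<Otimes>\<^sub>M list_space N (MX \<Otimes>\<^sub>M MY) \<rightarrow>\<^sub>M count_space UNIV"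
proof -
  have "(\<lambda>(c, x, t). S0 c x t) \<in> input_space MX MY n1 (N - n1) m \<rightarrow>\<^sub>M count_space UNIV"
    using assms(1) by (auto simp: selection_rule_def)
  from measurable_compose[OF pooled_input_measurable[OF assms(2)] this]
  show ?thesis by (simp add: case_prod_beta pooled_selection_def)
qed

text \<open>
  Both directions come from one identity: permuting the entries of \<open>D\<close> by \<open>\<sigma>\<close> maps the selection
  through \<open>inv \<sigma>\<close>, and \<open>inv \<sigma>\<close> is injective and maps \<open>s\<close> onto itself. If \<open>\<sigma>\<close> moved \<open>s\<close>
  to another set, the event that \<open>s\<close> is selected would become the event that this other set is selected.
\<close>

lemma pooled_selection_permute:
  assumes "permutation_preserving MX MY S0"
    and t: "t \<in> space (list_space m (MX \<Otimes>\<^sub>M MY))" and D: "D \<in> space (list_space N (MX \<Otimes>\<^sub>M MY))"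
    and "n1 \<le> N" and s: "s \<subseteq> {n1..<N}" and \<sigma>: "\<sigma> permutes s"
  shows "pooled_selection S0 n1 (permute_list \<sigma> D) t = s \<longleftrightarrow> pooled_selection S0 n1 D t = s"
proof -
  have len: "length D = N" using D by (simp add: space_list_space)
  let ?x = "map fst (drop n1 D)"
  have \<sigma>1: "\<sigma> permutes {n1..<N}" by (rule permutes_subset[OF \<sigma> s])
  have \<sigma>N: "\<sigma> permutes {..<length D}" by (rule permutes_subset[OF \<sigma>]) (use s len in auto)
  have head: "take n1 (permute_list \<sigma> D) = take n1 D"
  proof (rule nth_equalityI)
    fix i assume "i < length (take n1 (permute_list \<sigma> D))"
    moreover then have "\<sigma> i = i" using s by (intro permutes_not_in[OF \<sigma>]) auto
    ultimately show "take n1 (permute_list \<sigma> D) ! i = take n1 D ! i"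
      using \<sigma>N by (simp add: permute_list_nth)
  qed simp
  have inv_inv: "inv (inv \<sigma>) = \<sigma>" by (rule permutes_inv_inv[OF \<sigma>])
  \<comment> \<open>\<open>permute_list \<sigma>\<close> puts at position \<open>i\<close> the entry of index \<open>\<sigma> i\<close>, hence moves index \<open>j\<close> to \<open>inv \<sigma> j\<close>.\<close>
  have tail: "map fst (drop n1 (permute_list \<sigma> D)) = relabel n1 (inv \<sigma>) ?x"
  proof (rule nth_equalityI)
    fix i assume "i < length (map fst (drop n1 (permute_list \<sigma> D)))"
    then have i: "n1 + i < N" using len by simp
    then have "\<sigma> (n1 + i) \<in> {n1..<N}" using permutes_in_image[OF \<sigma>1, of "n1 + i"] by simp
    moreover then have "?x ! (\<sigma> (n1 + i) - n1) = fst (D ! \<sigma> (n1 + i))"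
      using len by (simp add: diff_less_mono)
    ultimately show "map fst (drop n1 (permute_list \<sigma> D)) ! i = relabel n1 (inv \<sigma>) ?x ! i"
      using i len \<sigma>N nth_upt[OF i] \<open>n1 \<le> N\<close> by (simp add: relabel_def inv_inv permute_list_nth)
  qed (simp add: relabel_def)
  have "(take n1 D, ?x, t) \<in> space (input_space MX MY n1 (N - n1) m)"
    using measurable_space[OF pooled_input_measurable[OF \<open>n1 \<le> N\<close>], of "(t, D)" m MX MY] t D
    by (simp add: space_pair_measure)
  moreover have "inv \<sigma> permutes {n1..<n1 + (N - n1)}"
    using permutes_inv[OF \<sigma>1] \<open>n1 \<le> N\<close> by simp
  ultimately have "S0 (take n1 D) (relabel n1 (inv \<sigma>) ?x) t = inv \<sigma> ` S0 (take n1 D) ?x t"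
    using assms(1) unfolding permutation_preserving_def by fast
  then have "pooled_selection S0 n1 (permute_list \<sigma> D) t = inv \<sigma> ` pooled_selection S0 n1 D t"
    by (simp add: pooled_selection_def head tail)
  moreover have "inv \<sigma> ` s = s" by (rule permutes_image[OF permutes_inv[OF \<sigma>]])
  moreover have "inj (inv \<sigma>)" using permutes_inj[OF permutes_inv[OF \<sigma>]] .
  ultimately show ?thesis by (metis inj_image_eq_iff)
qed

section \<open>The law of the selected data given the selection\<close>

definition selected_data ::
  "nat \<Rightarrow> nat \<Rightarrow> nat set \<Rightarrow> 't \<times> 'a list \<times> 'a list \<Rightarrow> 't \<times> 'a list \<times> 'a list" where
  "selected_data n1 k s = (\<lambda>(t, c, z). (t, subsample n1 (drop n1 c) s, subsample k z s))"

lemma selected_data_measurable: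
  assumes "n1 \<le> k"
  shows "selected_data n1 k s \<in> data_space MX MY m k n \<rightarrow>\<^sub>M
     data_space MX MY m (card (s \<inter> {n1..<k})) (card (s \<inter> {k..<k + n}))"
proof -
  have "n1 + (k - n1) = k" using assms by simp
  then have "(\<lambda>d. subsample n1 (drop n1 (fst (snd d))) s) \<in> data_space MX MY m k n \<rightarrow>\<^sub>M
      list_space (card (s \<inter> {n1..<k})) (MX \<Otimes>\<^sub>M MY)"
    unfolding data_space_def
    by (metis measurable_subsample measurable_list_drop measurable_compose[OF measurable_snd measurable_fst])
  then show ?thesis
    unfolding selected_data_def data_space_def case_prod_beta
    by (intro measurable_Pair measurable_subsample measurable_fst
      measurable_compose[OF measurable_snd measurable_snd])
qed

text \<open>
  Let \<open>\<pi>\<close> permute the kept entries, and let \<open>\<sigma>\<close> be its lift to \<open>s\<close>. The event that \<open>s\<close> is selected and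
  that the permuted kept data fall into \<open>B\<close> is the event that \<open>(t, \<sigma>(D))\<close> falls into a set \<open>W\<close>, where \<open>W\<close>
  is the same for all \<open>\<pi>\<close>; this is where the invariance of the selection event under \<open>\<sigma>\<close> is needed.
  Since \<open>(t, \<sigma>(D))\<close> and \<open>(t, D)\<close> have the same law, the probability does not depend on \<open>\<pi>\<close>.
\<close>

lemma exchangeable_law_given_selection:
  fixes MX :: "'x measure" and MY :: "'y measure" and S0 :: "('x, 'y) selection"
  assumes Q: "exchangeable_law MX MY m k n Q"
    and S0: "selection_rule MX MY S0" "permutation_preserving MX MY S0"
    and n1: "n1 \<le> k" and s: "s \<subseteq> {n1..<k + n}"
  defines "A \<equiv> {d \<in> space Q. (\<lambda>(t, c, z). initial_selection S0 n1 c (map fst z) t) d = s}"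
  assumes A: "emeasure Q A \<noteq> 0"
  shows "exchangeable_law MX MY m (card (s \<inter> {n1..<k})) (card (s \<inter> {k..<k + n}))
    (distr (uniform_measure Q A) (data_space MX MY m (card (s \<inter> {n1..<k})) (card (s \<inter> {k..<k + n})))
      (selected_data n1 k s))"
proof -
  interpret Q: prob_space Q using Q by (simp add: exchangeable_law_def)
  have sets_Q[measurable_cong]: "sets Q = sets (data_space MX MY m k n)"
    using Q by (simp add: exchangeable_law_def)
  let ?N = "k + n" and ?k = "card (s \<inter> {n1..<k})" and ?n = "card (s \<inter> {k..<k + n})"
  let ?L = "\<lambda>n. list_space n (MX \<Otimes>\<^sub>M MY)"
  let ?U = "uniform_measure Q A"
  let ?P = "distr ?U (data_space MX MY m ?k ?n) (selected_data n1 k s)"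
  have s': "s \<subseteq> {n1..}" using s by auto
  have card_s: "?k + ?n = card s" by (rule card_selected[OF s n1])
  have A_sets[measurable]: "A \<in> sets Q"
    using A emeasure_notin_sets by blast
  interpret U: prob_space ?U
    using A by (intro prob_space_uniform_measure) auto
  have meas: "measurable Q = measurable (data_space MX MY m k n)"
      "measurable ?U = measurable (data_space MX MY m k n)"
    by (auto intro!: ext measurable_cong_sets simp: sets_Q)
  have sel: "selected_data n1 k s \<in> ?U \<rightarrow>\<^sub>M data_space MX MY m ?k ?n"
    unfolding meas by (rule selected_data_measurable[OF n1])
  have space_Q: "t \<in> space (?L m) \<and> length c = k \<and> c @ z \<in> space (?L ?N)" if "(t, c, z) \<in> space Q" for t c z
    using that unfolding sets_eq_imp_space_eq[OF sets_Q]
    by (auto simp: data_space_def space_pair_measure space_list_space)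
  show ?thesis
  proof (subst exchangeable_law_iff, goal_cases)
    case 1
    show ?case by (rule U.prob_space_distr[OF sel])
  next
    case 2
    show ?case by simp
  next
    case 3
    have "distr ?P (?L m \<Otimes>\<^sub>M ?L (?k + ?n)) (\<lambda>(t, c, z). (t, permute_list \<pi> (c @ z)))
        = distr ?P (?L m \<Otimes>\<^sub>M ?L (?k + ?n)) (\<lambda>(t, c, z). (t, c @ z))"
      if \<pi>: "\<pi> permutes {..<?k + ?n}" for \<pi>
    proof (rule measure_eqI)
      fix B assume "B \<in> sets (distr ?P (?L m \<Otimes>\<^sub>M ?L (?k + ?n)) (\<lambda>(t, c, z). (t, permute_list \<pi> (c @ z))))"
      then have B[measurable]: "B \<in> sets (?L m \<Otimes>\<^sub>M ?L (card s))" by (simp add: card_s)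
      obtain \<sigma> where \<sigma>: "\<sigma> permutes s"
        and lift: "\<And>D :: ('x \<times> 'y) list. length D = ?N \<Longrightarrow> permute_list \<pi> (nths D s) = nths (permute_list \<sigma> D) s"
        using nths_permutation_lift[of s ?N \<pi>] s \<pi> card_s by (metis atLeastLessThan_iff lessThan_iff subset_iff)
      have \<sigma>N: "\<sigma> permutes {..<?N}" by (rule permutes_subset[OF \<sigma>]) (use s in auto)
      define W where "W = {w \<in> space (?L m \<Otimes>\<^sub>M ?L ?N).
        pooled_selection S0 n1 (snd w) (fst w) = s \<and> (fst w, nths (snd w) s) \<in> B}"
      have W[measurable]: "W \<in> sets (?L m \<Otimes>\<^sub>M ?L ?N)"
      proof -
        have card_eq: "{i. i < ?N \<and> i \<in> s} = s" using s by auto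
        have [measurable]: "(\<lambda>w. (fst w, nths (snd w) s)) \<in> ?L m \<Otimes>\<^sub>M ?L ?N \<rightarrow>\<^sub>M ?L m \<Otimes>\<^sub>M ?L (card s)"
          using measurable_list_nths[where N = "?L m \<Otimes>\<^sub>M ?L ?N" and A = s, OF measurable_snd]
          by (intro measurable_Pair measurable_fst) (simp add: card_eq)
        have [measurable]: "(\<lambda>w. pooled_selection S0 n1 (snd w) (fst w)) \<in> ?L m \<Otimes>\<^sub>M ?L ?N \<rightarrow>\<^sub>M count_space UNIV"
          using pooled_selection_measurable[OF S0(1), of n1 ?N m] n1 by (simp add: case_prod_beta)
        show ?thesis unfolding W_def by measurable
      qed
      have pool_\<rho>: "(\<lambda>(t, c, z). (t, permute_list \<rho> (c @ z))) \<in> Q \<rightarrow>\<^sub>M ?L m \<Otimes>\<^sub>M ?L ?N"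
        if "\<rho> permutes {..<?N}" for \<rho>
        unfolding meas by (rule permuted_pooled_data_measurable[OF that])
      \<comment> \<open>Used twice: for \<open>\<pi>\<close> with its lift \<open>\<sigma>\<close>, and for the identity.\<close>
      have prob_W: "emeasure (distr ?P (?L m \<Otimes>\<^sub>M ?L (?k + ?n)) (\<lambda>(t, c, z). (t, permute_list \<pi>' (c @ z)))) B
          = emeasure (distr Q (?L m \<Otimes>\<^sub>M ?L ?N) (\<lambda>(t, c, z). (t, permute_list \<rho> (c @ z)))) W / emeasure Q A"
        if \<rho>: "\<rho> permutes s" and \<pi>': "\<pi>' permutes {..<?k + ?n}"
          and lift: "\<And>D :: ('x \<times> 'y) list. length D = ?N \<Longrightarrow> permute_list \<pi>' (nths D s) = nths (permute_list \<rho> D) s"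
        for \<rho> \<pi>'
      proof -
        have \<rho>N: "\<rho> permutes {..<?N}" by (rule permutes_subset[OF \<rho>]) (use s in auto)
        let ?f = "\<lambda>(t, c, z). (t, permute_list \<pi>' (c @ z))"
        have f: "?f \<in> data_space MX MY m ?k ?n \<rightarrow>\<^sub>M ?L m \<Otimes>\<^sub>M ?L (?k + ?n)"
          by (rule permuted_pooled_data_measurable[OF \<pi>'])
        have f': "(\<lambda>d. ?f (selected_data n1 k s d)) \<in> ?U \<rightarrow>\<^sub>M ?L m \<Otimes>\<^sub>M ?L (?k + ?n)"
          by (rule measurable_compose[OF sel f])
        let ?V = "(\<lambda>d. ?f (selected_data n1 k s d)) -` B \<inter> space Q"
        have V: "?V \<in> sets Q" using measurable_sets[OF f', of B] B by (simp add: card_s)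
        have "distr ?P (?L m \<Otimes>\<^sub>M ?L (?k + ?n)) ?f = distr ?U (?L m \<Otimes>\<^sub>M ?L (?k + ?n)) (\<lambda>d. ?f (selected_data n1 k s d))"
          using f sel by (subst distr_distr) (simp_all add: comp_def)
        then have "emeasure (distr ?P (?L m \<Otimes>\<^sub>M ?L (?k + ?n)) ?f) B = emeasure ?U ?V"
          using emeasure_distr[OF f', of B] B by (simp add: card_s)
        also have "\<dots> = emeasure Q (A \<inter> ?V) / emeasure Q A"
          by (rule emeasure_uniform_measure[OF A_sets V])
        also have "A \<inter> ?V = (\<lambda>(t, c, z). (t, permute_list \<rho> (c @ z))) -` W \<inter> space Q"
        proof -
          have "d \<in> A \<inter> ?V \<longleftrightarrow> d \<in> (\<lambda>(t, c, z). (t, permute_list \<rho> (c @ z))) -` W" if d: "d \<in> space Q" for d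
          proof -
            obtain t c z where [simp]: "d = (t, c, z)" by (cases d)
            have tD: "t \<in> space (?L m)" "length c = k" "c @ z \<in> space (?L ?N)"
              using space_Q d by auto
            then have len: "length (c @ z) = ?N" by (simp add: space_list_space)
            have "(t, permute_list \<rho> (c @ z)) \<in> space (?L m \<Otimes>\<^sub>M ?L ?N)"
              using measurable_space[OF pool_\<rho>[OF \<rho>N] d] by simp
            moreover have "pooled_selection S0 n1 (permute_list \<rho> (c @ z)) t = s \<longleftrightarrow>
              initial_selection S0 n1 c (map fst z) t = s"
              using pooled_selection_permute[OF S0(2) tD(1,3) _ s \<rho>] n1 tD(2)
              by (simp add: initial_selection_pooled)
            moreover have "?f (selected_data n1 k s d) = (t, nths (permute_list \<rho> (c @ z)) s)"
              using subsample_append[OF s', of c z] n1 tD(2) lift[OF len] by (auto simp: selected_data_def)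
            ultimately show ?thesis using d by (auto simp: A_def W_def)
          qed
          moreover have "A \<subseteq> space Q" by (auto simp: A_def)
          ultimately show ?thesis by blast
        qed
        also have "emeasure Q ((\<lambda>(t, c, z). (t, permute_list \<rho> (c @ z))) -` W \<inter> space Q)
          = emeasure (distr Q (?L m \<Otimes>\<^sub>M ?L ?N) (\<lambda>(t, c, z). (t, permute_list \<rho> (c @ z)))) W"
          by (rule emeasure_distr[OF pool_\<rho>[OF \<rho>N] W, symmetric])
        finally show ?thesis .
      qed
      have "distr Q (?L m \<Otimes>\<^sub>M ?L ?N) (\<lambda>(t, c, z). (t, permute_list \<sigma> (c @ z)))
          = distr Q (?L m \<Otimes>\<^sub>M ?L ?N) (\<lambda>(t, c, z). (t, c @ z))"
        using Q exchangeable_law_iff[OF Q.prob_space_axioms sets_Q] \<sigma>N by blast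
      then show "emeasure (distr ?P (?L m \<Otimes>\<^sub>M ?L (?k + ?n)) (\<lambda>(t, c, z). (t, permute_list \<pi> (c @ z)))) B
        = emeasure (distr ?P (?L m \<Otimes>\<^sub>M ?L (?k + ?n)) (\<lambda>(t, c, z). (t, c @ z))) B"
        using prob_W[OF \<sigma> \<pi> lift] prob_W[OF permutes_id permutes_id] by (simp add: id_def)
    qed simp
    then show ?case by blast
  qed
qed

section \<open>Conditioning on a finitely valued variable\<close>

text \<open>
  The set \<open>A\<close> where the conditional expectation exceeds \<open>c\<close> belongs to \<open>F\<close>. The assumption for \<open>A\<close> says
  that the excess over \<open>c\<close> has integral at most 0 on \<open>A\<close>, so \<open>A\<close> is a null set. Finiteness of \<open>c\<close> allows
  the integrals to be subtracted.
\<close>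

lemma nn_cond_exp_le_const:
  assumes "finite_measure Q" "subalgebra Q F" and f[measurable]: "f \<in> borel_measurable Q"
    and c: "c < \<infinity>"
    and le: "\<And>A. A \<in> sets F \<Longrightarrow> (\<integral>\<^sup>+w. indicator A w * f w \<partial>Q) \<le> c * emeasure Q A"
  shows "AE w in Q. nn_cond_exp Q F f w \<le> c"
proof -
  interpret finite_measure Q by fact
  interpret finite_measure_subalgebra Q F using assms(2) by unfold_locales
  let ?g = "nn_cond_exp Q F f"
  define A where "A = {w \<in> space F. c < ?g w}"
  have A_F[measurable]: "A \<in> sets F" unfolding A_def by measurable
  then have A_Q[measurable]: "A \<in> sets Q" using assms(2) by (auto simp: subalgebra_def)
  have "(\<integral>\<^sup>+w. indicator A w * ?g w - indicator A w * c \<partial>Q)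
    = (\<integral>\<^sup>+w. indicator A w * ?g w \<partial>Q) - (\<integral>\<^sup>+w. indicator A w * c \<partial>Q)"
  proof (rule nn_integral_diff)
    have "(\<integral>\<^sup>+w. indicator A w * c \<partial>Q) = c * emeasure Q A"
      by (simp add: mult.commute[of _ c] nn_integral_cmult_indicator)
    then show "(\<integral>\<^sup>+w. indicator A w * c \<partial>Q) \<noteq> \<infinity>"
      using c by (simp add: ennreal_mult_eq_top_iff emeasure_eq_measure)
    show "AE w in Q. indicator A w * c \<le> indicator A w * ?g w"
      by (auto simp: A_def indicator_def)
  qed auto
  also have "\<dots> = 0"
  proof -
    have "c * emeasure Q A < \<infinity>"
      using c by (simp add: ennreal_mult_less_top emeasure_eq_measure)
    then show ?thesis
      using le[OF A_F] by (simp add: nn_cond_exp_intg mult.commute[of _ c] nn_integral_cmult_indicator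
        diff_eq_0_iff_ennreal)
  qed
  finally have "AE w in Q. indicator A w * ?g w - indicator A w * c = 0"
    by (subst (asm) nn_integral_0_iff_AE) auto
  then show ?thesis
  proof (rule AE_mp, intro AE_I2 impI)
    fix w assume "w \<in> space Q" and 0: "indicator A w * ?g w - indicator A w * c = 0"
    show "?g w \<le> c"
    proof (rule ccontr)
      assume "\<not> ?g w \<le> c"
      then have "w \<in> A" using \<open>w \<in> space Q\<close> assms(2) by (simp add: A_def subalgebra_def)
      then show False using 0 \<open>\<not> ?g w \<le> c\<close> by (auto simp: diff_eq_0_iff_ennreal)
    qed
  qed
qed

text \<open>
  Every event of the sigma-algebra generated by \<open>S\<close> is a finite disjoint union of level sets
  \<open>{S = s}\<close>, and both sides of the assumed inequality are additive over such unions.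
\<close>

lemma bounds_from_level_sets:
  assumes "prob_space Q" and I: "finite I" and S: "S \<in> Q \<rightarrow>\<^sub>M count_space I"
    and g[measurable]: "g \<in> borel_measurable Q" and c: "c < \<infinity>"
    and level: "\<And>s. s \<in> I \<Longrightarrow>
      (\<integral>\<^sup>+d. g d * indicator {d \<in> space Q. S d = s} d \<partial>Q) \<le> c * emeasure Q {d \<in> space Q. S d = s}"
  shows "AE d in Q. nn_cond_exp Q (vimage_algebra (space Q) S (count_space UNIV)) g d \<le> c"
    and "(\<integral>\<^sup>+d. g d \<partial>Q) \<le> c"
proof -
  interpret prob_space Q by fact
  let ?F = "vimage_algebra (space Q) S (count_space UNIV)"
  define A where "A s = {d \<in> space Q. S d = s}" for s
  have S_range: "S d \<in> I" if "d \<in> space Q" for d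
    using measurable_space[OF S that] by simp
  have S_preimage: "S -` C \<inter> space Q \<in> sets Q" for C
  proof -
    have "S -` (C \<inter> I) \<inter> space Q \<in> sets Q" by (rule measurable_sets[OF S]) simp
    also have "S -` (C \<inter> I) \<inter> space Q = S -` C \<inter> space Q" using S_range by auto
    finally show ?thesis .
  qed
  have A_sets[measurable]: "A s \<in> sets Q" for s
    using S_preimage[of "{s}"] by (simp add: A_def vimage_def Int_def conj_commute)
  have preimage_bound: "(\<integral>\<^sup>+d. indicator (S -` C \<inter> space Q) d * g d \<partial>Q)
      \<le> c * emeasure Q (S -` C \<inter> space Q)" for C
  proof -
    have decomp: "indicator (S -` C \<inter> space Q) d * f d = (\<Sum>s\<in>I \<inter> C. f d * indicator (A s) d)"
      if d: "d \<in> space Q" for d and f :: "_ \<Rightarrow> ennreal"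
    proof -
      have "(\<Sum>s\<in>I \<inter> C. f d * indicator (A s) d) = (\<Sum>s\<in>I \<inter> C. if s = S d then f d else 0)"
        using d by (intro sum.cong) (auto simp: A_def indicator_def)
      also have "\<dots> = (if S d \<in> I \<inter> C then f d else 0)"
        using I by (intro sum.delta) simp
      finally show ?thesis using S_range[OF d] d by (simp add: indicator_def)
    qed
    have "(\<integral>\<^sup>+d. indicator (S -` C \<inter> space Q) d * g d \<partial>Q)
        = (\<integral>\<^sup>+d. (\<Sum>s\<in>I \<inter> C. g d * indicator (A s) d) \<partial>Q)"
      by (rule nn_integral_cong) (rule decomp)
    also have "\<dots> = (\<Sum>s\<in>I \<inter> C. \<integral>\<^sup>+d. g d * indicator (A s) d \<partial>Q)"
      by (rule nn_integral_sum) measurable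
    also have "\<dots> \<le> (\<Sum>s\<in>I \<inter> C. c * emeasure Q (A s))"
      by (intro sum_mono) (simp add: A_def level)
    also have "\<dots> = (\<Sum>s\<in>I \<inter> C. \<integral>\<^sup>+d. c * indicator (A s) d \<partial>Q)"
      by (simp add: nn_integral_cmult_indicator)
    also have "\<dots> = (\<integral>\<^sup>+d. (\<Sum>s\<in>I \<inter> C. c * indicator (A s) d) \<partial>Q)"
      by (rule nn_integral_sum[symmetric]) measurable
    also have "\<dots> = (\<integral>\<^sup>+d. c * indicator (S -` C \<inter> space Q) d \<partial>Q)"
      using decomp[of _ "\<lambda>_. c"] by (intro nn_integral_cong) (metis mult.commute)
    also have "\<dots> = c * emeasure Q (S -` C \<inter> space Q)"
      by (rule nn_integral_cmult_indicator) (rule S_preimage)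
    finally show ?thesis .
  qed
  have sets_F: "sets ?F = {S -` C \<inter> space Q |C. C \<in> sets (count_space UNIV)}"
    by (rule sets_vimage_algebra2) simp
  show "AE d in Q. nn_cond_exp Q ?F g d \<le> c"
  proof (rule nn_cond_exp_le_const[OF finite_measure_axioms _ g c])
    show "subalgebra Q ?F"
      unfolding subalgebra_def sets_F using S_preimage by auto
    show "(\<integral>\<^sup>+d. indicator H d * g d \<partial>Q) \<le> c * emeasure Q H" if "H \<in> sets ?F" for H
      using that preimage_bound unfolding sets_F by blast
  qed
  have "(\<integral>\<^sup>+d. g d \<partial>Q) = (\<integral>\<^sup>+d. indicator (S -` UNIV \<inter> space Q) d * g d \<partial>Q)"
    by (rule nn_integral_cong) simp
  also have "\<dots> \<le> c * emeasure Q (S -` UNIV \<inter> space Q)" by (rule preimage_bound)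
  also have "\<dots> = c" by (simp add: emeasure_space_1)
  finally show "(\<integral>\<^sup>+d. g d \<partial>Q) \<le> c" .
qed

section \<open>Error control\<close>

lemma error_measurable:
  assumes E: "error_criterion MY Out E" and R: "is_procedure MX MY Out R"
  shows "(\<lambda>(t, c, z). ennreal (E (R c (map fst z) t) (map snd z)))
    \<in> borel_measurable (data_space MX MY m k n)"
proof -
  have "(\<lambda>(t, c, z). (c, map fst z, t)) \<in> data_space MX MY m k n \<rightarrow>\<^sub>M input_space MX MY k n m"
    unfolding data_space_def input_space_def case_prod_beta
    by (intro measurable_Pair measurable_list_map[OF _ measurable_fst[of MX MY]] measurable_fst
        measurable_compose[OF measurable_snd measurable_fst] measurable_compose[OF measurable_snd measurable_snd])
  moreover have "(\<lambda>(c, x, t). R c x t) \<in> input_space MX MY k n m \<rightarrow>\<^sub>M Out n"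
    using R by (auto simp: is_procedure_def)
  ultimately have "(\<lambda>d. (\<lambda>(c, x, t). R c x t) ((\<lambda>(t, c, z). (c, map fst z, t)) d))
    \<in> data_space MX MY m k n \<rightarrow>\<^sub>M Out n"
    by (rule measurable_compose)
  moreover have "(\<lambda>(t, c, z). map snd z) \<in> data_space MX MY m k n \<rightarrow>\<^sub>M list_space n MY"
    unfolding data_space_def case_prod_beta
    by (intro measurable_list_map[OF _ measurable_snd[of MX MY]]
        measurable_compose[OF measurable_snd measurable_snd])
  ultimately have "(\<lambda>(t, c, z). (R c (map fst z) t, map snd z))
    \<in> data_space MX MY m k n \<rightarrow>\<^sub>M Out n \<Otimes>\<^sub>M list_space n MY"
    by (auto intro!: measurable_Pair simp: split_beta')
  moreover have "(\<lambda>(C, y). E C y) \<in> borel_measurable (Out n \<Otimes>\<^sub>M list_space n MY)"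
    using E by (auto simp: error_criterion_def)
  ultimately have "(\<lambda>d. (\<lambda>(C, y). E C y) ((\<lambda>(t, c, z). (R c (map fst z) t, map snd z)) d))
    \<in> borel_measurable (data_space MX MY m k n)"
    by (rule measurable_compose)
  then show ?thesis by (simp add: case_prod_beta)
qed

lemma initial_selection_measurable:
  assumes S0: "selection_rule MX MY S0" and n1: "n1 \<le> k"
  shows "(\<lambda>(t, c, z). initial_selection S0 n1 c (map fst z) t)
    \<in> data_space MX MY m k n \<rightarrow>\<^sub>M count_space (Pow {n1..<k + n})"
proof -
  let ?N = "k + n" and ?L = "\<lambda>n. list_space n (MX \<Otimes>\<^sub>M MY)"
  have pool: "(\<lambda>(t, D). pooled_selection S0 n1 D t)
      \<in> ?L m \<Otimes>\<^sub>M ?L ?N \<rightarrow>\<^sub>M count_space (Pow {n1..<?N})"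
  proof (subst measurable_count_space_eq2, simp, intro conjI ballI funcsetI)
    fix w assume "w \<in> space (?L m \<Otimes>\<^sub>M ?L ?N)"
    moreover obtain t D where w: "w = (t, D)" by (cases w)
    ultimately have "(take n1 D, map fst (drop n1 D), t) \<in> space (input_space MX MY n1 (?N - n1) m)"
      using measurable_space[OF pooled_input_measurable[of n1 ?N], of w m MX MY] n1 by simp
    then have "pooled_selection S0 n1 D t \<subseteq> {n1..<n1 + (?N - n1)}"
      using S0 unfolding selection_rule_def pooled_selection_def by fast
    then show "(case w of (t, D) \<Rightarrow> pooled_selection S0 n1 D t) \<in> Pow {n1..<?N}"
      using n1 by (simp add: w)
  next
    fix s
    show "(\<lambda>(t, D). pooled_selection S0 n1 D t) -` {s} \<inter> space (?L m \<Otimes>\<^sub>M ?L ?N) \<in> sets (?L m \<Otimes>\<^sub>M ?L ?N)"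
      by (rule measurable_sets[OF pooled_selection_measurable[OF S0]]) (use n1 in auto)
  qed
  from measurable_compose[OF pooled_data_measurable this]
  show ?thesis
  proof (rule measurable_cong[THEN iffD1, rotated])
    fix d assume "d \<in> space (data_space MX MY m k n)"
    then show "(case case d of (t, c, z) \<Rightarrow> (t, c @ z) of (t, D) \<Rightarrow> pooled_selection S0 n1 D t)
      = (case d of (t, c, z) \<Rightarrow> initial_selection S0 n1 c (map fst z) t)"
      using n1 by (auto simp: data_space_def space_pair_measure space_list_space initial_selection_pooled)
  qed
qed

text \<open>
  Once the value \<open>s\<close> of the selection is fixed, the split error is the error of \<open>R\<close> itself on the
  selected data, which is what the assumption on \<open>R\<close> controls.
\<close>

lemma split_error_eq_error_selected:
  assumes "initial_selection S0 n1 c (map fst z) t = s"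
  shows "split_error E R S0 n1 t c z =
    (\<lambda>(t, c, z). E (R c (map fst z) t) (map snd z)) (selected_data n1 (length c) s (t, c, z))"
  using assms
  by (simp add: selected_data_def split_error_def split_procedure_def Let_def subsample_def nths_map)

theorem lemmaH5:
  fixes MX :: "'x measure" and MY :: "'y measure"
    and Out :: "nat \<Rightarrow> (nat \<rightharpoonup> 'y set) measure"
    and E :: "(nat \<rightharpoonup> 'y set) \<Rightarrow> 'y list \<Rightarrow> real"
    and R :: "('x, 'y) procedure" and S0 :: "('x, 'y) selection"
    and \<alpha> :: real and n_train n_cal n_cal1 n_test :: nat
    and Q :: "(('x \<times> 'y) list \<times> ('x \<times> 'y) list \<times> ('x \<times> 'y) list) measure"
  assumes "0 < \<alpha>" and "\<alpha> < 1"
    and "error_criterion MY Out E"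
    and "is_procedure MX MY Out R"
    and "selection_rule MX MY S0"
    and control: "\<And>m k n P. exchangeable_law MX MY m k n P \<Longrightarrow>
      (\<integral>\<^sup>+(t, c, z). ennreal (E (R c (map fst z) t) (map snd z)) \<partial>P) \<le> ennreal \<alpha>"
    and "permutation_preserving MX MY S0"
    and "exchangeable_law MX MY n_train n_cal n_test Q"
    and "n_cal1 \<le> n_cal"
  shows "(AE d in Q.
      nn_cond_exp Q
        (vimage_algebra (space Q)
          (\<lambda>(t, c, z). initial_selection S0 n_cal1 c (map fst z) t) (count_space UNIV))
        (\<lambda>(t, c, z). ennreal (split_error E R S0 n_cal1 t c z)) d \<le> ennreal \<alpha>) \<and>
    (\<integral>\<^sup>+(t, c, z). ennreal (split_error E R S0 n_cal1 t c z) \<partial>Q) \<le> ennreal \<alpha>"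
proof -
  interpret Q: prob_space Q using assms(8) by (simp add: exchangeable_law_def)
  have sets_Q[measurable_cong]: "sets Q = sets (data_space MX MY n_train n_cal n_test)"
    using assms(8) by (simp add: exchangeable_law_def)
  have meas: "measurable M = measurable (data_space MX MY n_train n_cal n_test)"
    if "sets M = sets Q" for M
    by (intro ext measurable_cong_sets refl) (simp add: that sets_Q)
  let ?S = "\<lambda>(t, c, z). initial_selection S0 n_cal1 c (map fst z) t"
  let ?g = "\<lambda>(t, c, z). ennreal (split_error E R S0 n_cal1 t c z)"
  let ?I = "Pow {n_cal1..<n_cal + n_test}"
  define A where "A s = {d \<in> space Q. ?S d = s}" for s
  define loss where "loss = (\<lambda>(t, c, z). ennreal (E (R c (map fst z) t) (map snd z)))"
  define h where "h s d = loss (selected_data n_cal1 n_cal s d)" for s d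
  have S_meas: "?S \<in> Q \<rightarrow>\<^sub>M count_space ?I"
    unfolding meas[OF refl] by (rule initial_selection_measurable[OF assms(5,9)])
  have h_meas[measurable]: "h s \<in> borel_measurable Q" for s
    unfolding h_def[abs_def] meas[OF refl] loss_def
    by (rule measurable_compose[OF selected_data_measurable[OF assms(9)] error_measurable[OF assms(3,4)]])
  have g_h: "?g d = h (?S d) d" if "d \<in> space Q" for d
  proof -
    obtain t c z where d: "d = (t, c, z)" by (cases d)
    have "length c = n_cal"
      using that unfolding d sets_eq_imp_space_eq[OF sets_Q]
      by (simp add: data_space_def space_pair_measure space_list_space)
    then show ?thesis
      by (simp add: d h_def loss_def split_error_eq_error_selected[OF refl] case_prod_beta)
  qed
  \<comment> \<open>A random choice among finitely many measurable functions.\<close>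
  have "(\<lambda>d. h (?S d) d) \<in> borel_measurable Q"
    by (rule measurable_compose_countable'[OF _ S_meas]) (auto intro: countable_finite)
  then have g_meas: "?g \<in> borel_measurable Q"
    by (rule measurable_cong[THEN iffD1, rotated]) (rule g_h[symmetric])
  have level: "(\<integral>\<^sup>+d. ?g d * indicator (A s) d \<partial>Q) \<le> ennreal \<alpha> * emeasure Q (A s)" if s: "s \<in> ?I" for s
  proof -
    have A_sets[measurable]: "A s \<in> sets Q"
      using measurable_sets[OF S_meas, of "{s}"] s by (simp add: A_def vimage_def Int_def conj_commute)
    have g_A: "(\<integral>\<^sup>+d. ?g d * indicator (A s) d \<partial>Q) = (\<integral>\<^sup>+d. h s d * indicator (A s) d \<partial>Q)"
    proof (rule nn_integral_cong)
      fix d assume "d \<in> space Q"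
      then show "?g d * indicator (A s) d = h s d * indicator (A s) d"
        unfolding g_h[OF \<open>d \<in> space Q\<close>] by (simp add: A_def indicator_def)
    qed
    show ?thesis
    proof (cases "emeasure Q (A s) = 0")
      case True
      then have "AE d in Q. d \<notin> A s" by (intro AE_not_in) (simp add: null_sets_def)
      then have "(\<integral>\<^sup>+d. h s d * indicator (A s) d \<partial>Q) = 0"
        by (subst nn_integral_0_iff_AE) (auto elim!: eventually_mono)
      then show ?thesis by (simp add: g_A)
    next
      case False
      let ?M = "data_space MX MY n_train
        (card (s \<inter> {n_cal1..<n_cal})) (card (s \<inter> {n_cal..<n_cal + n_test}))"
      let ?U = "uniform_measure Q (A s)"
      \<comment> \<open>The conditional expectation of the error given \<open>{S = s}\<close> is an expectation under the law of the
        selected data given this event, which is exchangeable.\<close>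
      have "(\<integral>\<^sup>+d. h s d * indicator (A s) d \<partial>Q) / emeasure Q (A s) = (\<integral>\<^sup>+d. h s d \<partial>?U)"
        by (rule nn_integral_uniform_measure[symmetric]) auto
      also have "\<dots> = (\<integral>\<^sup>+d. loss d \<partial>distr ?U ?M (selected_data n_cal1 n_cal s))"
        unfolding h_def loss_def
      proof (rule nn_integral_distr[symmetric])
        show "selected_data n_cal1 n_cal s \<in> ?U \<rightarrow>\<^sub>M ?M"
          unfolding meas[OF sets_uniform_measure] by (rule selected_data_measurable[OF assms(9)])
      qed (use error_measurable[OF assms(3,4)] in simp)
      also have "\<dots> \<le> ennreal \<alpha>"
        unfolding loss_def
        by (rule control[OF exchangeable_law_given_selection[OF assms(8,5,7,9), folded A_def]])
          (use s False in auto)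
      finally have "(\<integral>\<^sup>+d. h s d * indicator (A s) d \<partial>Q) / emeasure Q (A s) * emeasure Q (A s)
          \<le> ennreal \<alpha> * emeasure Q (A s)"
        by (rule mult_right_mono) simp
      then show ?thesis
        using False by (simp add: g_A ennreal_divide_times Q.emeasure_eq_measure)
    qed
  qed
  have "finite ?I" and "ennreal \<alpha> < \<infinity>" by simp_all
  from bounds_from_level_sets[OF Q.prob_space_axioms this(1) S_meas g_meas this(2)
      level[unfolded A_def]]
  show ?thesis by blast
qed

end
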